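(* Let $\mathbb{F}$ be a field with $|\mathbb{F}|>2$ and let $n\ge 3$. Suppose that $\boldsymbol{\lambda}\in\mathcal{M}^{\ast\ast}$ but $\boldsymbol{\lambda}\notin\mathcal{M}^{\ast}$. Then $\boldsymbol{\lambda}$ linearly degenerates to $\boldsymbol{\eta}$, so $\mathcal{U}\subseteq\boldsymbol{\lambda}(\mathbb{F}G)$. Moreover, $\mathcal{U}/(\mathcal{U}\cap\mathcal{M}^{\ast})$ is an irreducible $G$-module.
   Context: $V$ is an $n$-dimensional vector space over $\mathbb{F}$ with a fixed basis $v_1,\dots,v_n$; $G=GL(V)$ acts on $V$ on the left. $\boldsymbol{\Lambda}=\mathbb{F}^{n^3}$ is the space of structure vectors $\boldsymbol{\lambda}=(\lambda_{ijk})_{1\le i,j,k\le n}$; such a vector corresponds to the (not necessarily associative) algebra on $V$ whose bilinear product is $[v_i,v_j]=\sum_k\lambda_{ijk}v_k$. $G$ acts linearly on $\boldsymbol{\Lambda}$ on the right: $\boldsymbol{\lambda}g$ is the structure vector of the product $[u,v]'=g^{-1}[gu,gv]$. This makes $\boldsymbol{\Lambda}$ a right module over the group algebra $\mathbb{F}G$; $\boldsymbol{\lambda}$ linearly degenerates to $\boldsymbol{\lambda}'$ if $\boldsymbol{\lambda}'\in\boldsymbol{\lambda}(\mathbb{F}G)$, the $G$-submodule generated by $\boldsymbol{\lambda}$. Write $\mathbf{abc}$ for the standard basis vector of $\boldsymbol{\Lambda}$ with $\lambda_{abc}=1$ and all other components $0$; $\boldsymbol{\eta}=\mathbf{123}-\mathbf{213}$.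 Define the following $G$-submodules of $\boldsymbol{\Lambda}$ (where $[\,,\,]$ is the product with structure vector $\boldsymbol{\lambda}$): $\mathcal{K}$ = all $\boldsymbol{\lambda}$ with $[v,v]=0$ for all $v\in V$; $\mathcal{T}$ = all $\boldsymbol{\lambda}$ such that for every $u\in V$ the linear map $v\mapsto[u,v]$ has trace $0$; $\mathcal{U}=\mathcal{K}\cap\mathcal{T}$; $\mathcal{M}^{\ast}$ = all $\boldsymbol{\lambda}$ such that $[u,v]$ lies in the $\mathbb{F}$-span of $u,v$ for all $u,v\in V$; $\mathcal{M}^{\ast\ast}$ = all $\boldsymbol{\lambda}$ with $[v,v]\in\mathbb{F}v$ for all $v\in V$. *)

theory Defs
  imports
    "HOL-Analysis.Analysis"
    "HOL-Library.Poly_Mapping"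
    "HOL-Algebra.Module"
    "HOL-Algebra.AbelCoset"
begin

section \<open>Structure vectors and the action of the general linear group\<close>

text \<open>
  The vector space \<open>V\<close> is \<open>'a ^ 'n\<close> with its standard basis \<open>axis i 1\<close>, and \<open>GL(V)\<close> is the
  group of invertible matrices.  The space of structure vectors is \<open>'a ^ ('n \<times> 'n \<times> 'n)\<close>; its
  scalar multiplication is \<open>*s\<close>.
\<close>

type_synonym ('a, 'n) svec = "'a ^ ('n \<times> 'n \<times> 'n)"

definition alg_prod :: "('a::field, 'n::finite) svec \<Rightarrow> 'a ^ 'n \<Rightarrow> 'a ^ 'n \<Rightarrow> 'a ^ 'n" where
  "alg_prod lam u v = (\<chi> k. \<Sum>i\<in>UNIV. \<Sum>j\<in>UNIV. u $ i * v $ j * lam $ (i, j, k))"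

definition structure_vector :: "('a::field ^ 'n::finite \<Rightarrow> 'a ^ 'n \<Rightarrow> 'a ^ 'n) \<Rightarrow> ('a, 'n) svec" where
  "structure_vector m = vec_lambda (\<lambda>(i, j, k). m (axis i 1) (axis j 1) $ k)"

definition sv_act :: "('a::field, 'n::finite) svec \<Rightarrow> 'a ^ 'n ^ 'n \<Rightarrow> ('a, 'n) svec" where
  "sv_act lam g = structure_vector (\<lambda>u v. matrix_inv g *v alg_prod lam (g *v u) (g *v v))"

definition GL :: "('a::field ^ 'n::finite ^ 'n) monoid" where
  "GL = \<lparr>carrier = {g. invertible g}, mult = (**), one = mat 1\<rparr>"

text \<open>
  Elements of the group algebra are finitely supported functions whose support lies in the group.
\<close>

definition group_algebra :: "(('a::field ^ 'n::finite ^ 'n) \<Rightarrow>\<^sub>0 'a) set" where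
  "group_algebra = {x. Poly_Mapping.keys x \<subseteq> carrier GL}"

definition sv_algebra_act ::
  "('a::field, 'n::finite) svec \<Rightarrow> (('a ^ 'n ^ 'n) \<Rightarrow>\<^sub>0 'a) \<Rightarrow> ('a, 'n) svec" where
  "sv_algebra_act lam x =
     (\<Sum>g\<in>Poly_Mapping.keys x. Poly_Mapping.lookup x g *s sv_act lam g)"

definition FG_orbit :: "('a::field, 'n::finite) svec \<Rightarrow> ('a, 'n) svec set" where
  "FG_orbit lam = sv_algebra_act lam ` group_algebra"

definition linearly_degenerates :: "('a::field, 'n::finite) svec \<Rightarrow> ('a, 'n) svec \<Rightarrow> bool" where
  "linearly_degenerates lam lam' \<longleftrightarrow> lam' \<in> FG_orbit lam"


section \<open>The particular structure vectors and submodules\<close>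

text \<open>
  The argument \<open>b\<close> enumerates the index type, so that \<open>axis (b 1) 1, axis (b 2) 1, \<dots>\<close> is the
  ordered basis \<open>v\<^sub>1, v\<^sub>2, \<dots>\<close>.
\<close>

definition unit_sv :: "(nat \<Rightarrow> 'n::finite) \<Rightarrow> nat \<Rightarrow> nat \<Rightarrow> nat \<Rightarrow> ('a::field, 'n) svec" where
  "unit_sv b i j k = axis (b i, b j, b k) 1"

definition eta :: "(nat \<Rightarrow> 'n::finite) \<Rightarrow> ('a::field, 'n) svec" where
  "eta b = unit_sv b 1 2 3 - unit_sv b 2 1 3"

definition K_mod :: "('a::field, 'n::finite) svec set" where
  "K_mod = {lam. \<forall>v. alg_prod lam v v = 0}"

definition T_mod :: "('a::field, 'n::finite) svec set" where
  "T_mod = {lam. \<forall>u. trace (matrix (alg_prod lam u)) = 0}"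

definition U_mod :: "('a::field, 'n::finite) svec set" where
  "U_mod = K_mod \<inter> T_mod"

definition M_star :: "('a::field, 'n::finite) svec set" where
  "M_star = {lam. \<forall>u v. alg_prod lam u v \<in> vec.span {u, v}}"

definition M_star_star :: "('a::field, 'n::finite) svec set" where
  "M_star_star = {lam. \<forall>v. alg_prod lam v v \<in> vec.span {v}}"


section \<open>Modules with a linear right group action\<close>

record ('f, 'm, 'g) gmodule = "('f, 'm) module" +
  act :: "'m \<Rightarrow> 'g \<Rightarrow> 'm"

locale right_gmodule = Module.module R M + G?: group G
  for R (structure) and G (structure) and M :: "('f, 'm, 'g, 'z) gmodule_scheme" (structure) +
  assumes field_R: "field R"
    and act_closed: "\<lbrakk>x \<in> carrier M; g \<in> carrier G\<rbrakk> \<Longrightarrow> act M x g \<in> carrier M"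
    and act_one: "x \<in> carrier M \<Longrightarrow> act M x \<one>\<^bsub>G\<^esub> = x"
    and act_mult: "\<lbrakk>x \<in> carrier M; g \<in> carrier G; h \<in> carrier G\<rbrakk>
          \<Longrightarrow> act M x (g \<otimes>\<^bsub>G\<^esub> h) = act M (act M x g) h"
    and act_add: "\<lbrakk>x \<in> carrier M; y \<in> carrier M; g \<in> carrier G\<rbrakk>
          \<Longrightarrow> act M (x \<oplus>\<^bsub>M\<^esub> y) g = act M x g \<oplus>\<^bsub>M\<^esub> act M y g"
    and act_smult: "\<lbrakk>c \<in> carrier R; x \<in> carrier M; g \<in> carrier G\<rbrakk>
          \<Longrightarrow> act M (c \<odot>\<^bsub>M\<^esub> x) g = c \<odot>\<^bsub>M\<^esub> act M x g"

definition G_submodule ::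
  "'m set \<Rightarrow> 'f ring \<Rightarrow> 'g monoid \<Rightarrow> ('f, 'm, 'g) gmodule \<Rightarrow> bool" where
  "G_submodule W R G M \<longleftrightarrow>
     submodule W R M \<and> (\<forall>x\<in>W. \<forall>g\<in>carrier G. act M x g \<in> W)"

definition irreducible_gmodule ::
  "'f ring \<Rightarrow> 'g monoid \<Rightarrow> ('f, 'm, 'g) gmodule \<Rightarrow> bool" where
  "irreducible_gmodule R G M \<longleftrightarrow>
     right_gmodule R G M \<and> carrier M \<noteq> {\<zero>\<^bsub>M\<^esub>} \<and>
     (\<forall>W. G_submodule W R G M \<longrightarrow> W = {\<zero>\<^bsub>M\<^esub>} \<or> W = carrier M)"

text \<open>
  In \<open>c \<odot> A\<close> and \<open>act A g\<close> the union runs over the representatives of the coset \<open>A\<close>.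
  The record type of modules inherits ring multiplication and unit fields, which are irrelevant
  for modules and left undefined here.
\<close>

definition quotient_gmodule ::
  "('f, 'm, 'g) gmodule \<Rightarrow> 'm set \<Rightarrow> ('f, 'm set, 'g) gmodule" where
  "quotient_gmodule M N =
     \<lparr>carrier = a_rcosets\<^bsub>M\<^esub> N, mult = undefined, one = undefined,
      zero = N, add = (<+>\<^bsub>M\<^esub>),
      smult = (\<lambda>c A. \<Union>x\<in>A. N +>\<^bsub>M\<^esub> (c \<odot>\<^bsub>M\<^esub> x)),
      act = (\<lambda>A g. \<Union>x\<in>A. N +>\<^bsub>M\<^esub> act M x g)\<rparr>"

definition scalar_ring :: "'a::field ring" where
  "scalar_ring = \<lparr>carrier = UNIV, mult = (*), one = 1, zero = 0, add = (+)\<rparr>"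

definition sv_gmodule ::
  "('a::field, 'n::finite) svec set \<Rightarrow> ('a, ('a, 'n) svec, 'a ^ 'n ^ 'n) gmodule" where
  "sv_gmodule W =
     \<lparr>carrier = W, mult = undefined, one = undefined,
      zero = 0, add = (+), smult = (*s), act = sv_act\<rparr>"


section \<open>Consistency of the definitions\<close>


lemma alg_prod_bilinear:
  "alg_prod lam (u + u') v = alg_prod lam u v + alg_prod lam u' v"
  "alg_prod lam u (v + v') = alg_prod lam u v + alg_prod lam u v'"
  "alg_prod lam (c *s u) v = c *s alg_prod lam u v"
  "alg_prod lam u (c *s v) = c *s alg_prod lam u v"
  by (simp_all add: alg_prod_def vec_eq_iff algebra_simps sum.distrib sum_distrib_left)

lemma alg_prod_linear_sv:
  "alg_prod 0 u v = 0"
  "alg_prod (lam + mu) u v = alg_prod lam u v + alg_prod mu u v"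
  "alg_prod (c *s lam) u v = c *s alg_prod lam u v"
  by (simp_all add: alg_prod_def vec_eq_iff algebra_simps sum.distrib sum_distrib_left)

lemma alg_prod_axis: "alg_prod lam (axis i 1) (axis j 1) $ k = lam $ (i, j, k)"
proof -
  have "alg_prod lam (axis i 1) (axis j 1) $ k
     = (\<Sum>i'\<in>UNIV. \<Sum>j'\<in>UNIV. if j' = j then (if i' = i then lam $ (i', j', k) else 0) else 0)"
    unfolding alg_prod_def axis_def vec_lambda_beta by (intro sum.cong refl) auto
  thus ?thesis by simp
qed

lemma svec_eqI:
  assumes "\<And>u v. alg_prod lam u v = alg_prod mu u v"
  shows "lam = mu"
  using assms by (simp add: vec_eq_iff flip: alg_prod_axis)

lemma alg_prod_structure_vector:
  assumes l: "\<And>v. Vector_Spaces.linear (*s) (*s) (\<lambda>u. m u v)"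
    and r: "\<And>u. Vector_Spaces.linear (*s) (*s) (\<lambda>v. m u v)"
  shows "alg_prod (structure_vector m) u v = m u v"
proof -
  have "m u v = m (\<Sum>i\<in>UNIV. u $ i *s axis i 1) (\<Sum>j\<in>UNIV. v $ j *s axis j 1)"
    by (simp add: basis_expansion)
  also have "\<dots> = (\<Sum>i\<in>UNIV. \<Sum>j\<in>UNIV. (u $ i * v $ j) *s m (axis i 1) (axis j 1))"
    unfolding vec.linear_sum[OF l] vec.linear_scale[OF l] vec.linear_sum[OF r]
      vec.linear_scale[OF r] vec.scale_sum_right vec.scale_scale
    by (subst sum.swap) (simp only: mult.commute)
  finally show ?thesis
    by (simp add: alg_prod_def structure_vector_def vec_eq_iff sum_component)
qed

lemma alg_prod_sv_act:
  "alg_prod (sv_act lam g) u v = matrix_inv g *v alg_prod lam (g *v u) (g *v v)"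
  unfolding sv_act_def
  by (rule alg_prod_structure_vector; unfold_locales)
    (simp_all add: alg_prod_bilinear vec.add vec.scale)

lemma matrix_inv_r:
  fixes g :: "'a::field ^ 'n ^ 'n"
  assumes "invertible g"
  shows "g ** matrix_inv g = mat 1"
proof -
  have "\<exists>h. g ** h = mat 1 \<and> h ** g = mat 1"
    using assms by (simp add: invertible_def)
  from someI_ex[OF this] show ?thesis
    unfolding matrix_inv_def by (rule conjunct1)
qed

lemma matrix_invI:
  fixes g :: "'a::field ^ 'n ^ 'n"
  assumes "g ** h = mat 1"
  shows "matrix_inv g = h"
proof -
  have hg: "h ** g = mat 1"
    using assms by (simp add: matrix_left_right_inverse)
  have "invertible g"
    using assms hg by (auto simp: invertible_def)
  have "matrix_inv g = (h ** g) ** matrix_inv g"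
    by (simp add: hg)
  also have "\<dots> = h"
    by (simp add: matrix_inv_r[OF \<open>invertible g\<close>] flip: matrix_mul_assoc)
  finally show ?thesis .
qed

lemma sv_act_mult:
  assumes "invertible g" "invertible h"
  shows "sv_act lam (g ** h) = sv_act (sv_act lam g) h"
proof -
  have "matrix_inv (g ** h) = matrix_inv h ** matrix_inv g"
  proof (rule matrix_invI)
    have "g ** h ** (matrix_inv h ** matrix_inv g) = g ** (h ** matrix_inv h) ** matrix_inv g"
      by (simp only: matrix_mul_assoc)
    thus "g ** h ** (matrix_inv h ** matrix_inv g) = mat 1"
      by (simp add: matrix_inv_r assms)
  qed
  thus ?thesis
    by (intro svec_eqI) (simp add: alg_prod_sv_act matrix_vector_mul_assoc)
qed

lemma sv_act_one: "sv_act lam (mat 1) = (lam :: ('a::field, 'n::finite) svec)"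
proof -
  have "matrix_inv (mat 1 :: 'a ^ 'n ^ 'n) = mat 1" by (rule matrix_invI) simp
  thus ?thesis by (intro svec_eqI) (simp add: alg_prod_sv_act)
qed

lemma sv_act_linear:
  "sv_act (lam + mu) g = sv_act lam g + sv_act mu g"
  "sv_act (c *s lam) g = c *s sv_act lam g"
  by (intro svec_eqI; simp add: alg_prod_sv_act alg_prod_linear_sv vec.add vec.scale)+

lemma group_GL: "group (GL :: ('a::field ^ 'n::finite ^ 'n) monoid)"
proof (rule groupI)
  fix x :: "'a ^ 'n ^ 'n" assume "x \<in> carrier GL"
  thus "\<exists>y\<in>carrier GL. y \<otimes>\<^bsub>GL\<^esub> x = \<one>\<^bsub>GL\<^esub>" by (auto simp: GL_def invertible_def)
qed (auto simp: GL_def invertible_mult matrix_mul_assoc, auto simp: invertible_def intro: exI[of _ "mat 1"])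

lemma FG_orbit_eq_span: "FG_orbit lam = vec.span (sv_act lam ` carrier GL)"
proof
  show "FG_orbit lam \<subseteq> vec.span (sv_act lam ` carrier GL)"
    unfolding FG_orbit_def sv_algebra_act_def group_algebra_def
    by (intro subsetI, elim imageE) (auto intro!: vec.span_sum vec.span_scale intro: vec.span_base)
next
  have zero: "0 \<in> FG_orbit lam"
    unfolding FG_orbit_def by (intro image_eqI[of _ _ 0]) (auto simp: group_algebra_def sv_algebra_act_def)
  have act: "sv_algebra_act lam x = (\<Sum>g\<in>S. Poly_Mapping.lookup x g *s sv_act lam g)"
    if "finite S" "Poly_Mapping.keys x \<subseteq> S" for x S
    unfolding sv_algebra_act_def by (rule sum.mono_neutral_left) (use that in \<open>auto simp: in_keys_iff\<close>)
  have "x + y \<in> FG_orbit lam" if "x \<in> FG_orbit lam" "y \<in> FG_orbit lam" for x y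
  proof -
    obtain p q where p: "p \<in> group_algebra" "x = sv_algebra_act lam p"
      and q: "q \<in> group_algebra" "y = sv_algebra_act lam q"
      using \<open>x \<in> _\<close> \<open>y \<in> _\<close> by (auto simp: FG_orbit_def)
    let ?S = "Poly_Mapping.keys p \<union> Poly_Mapping.keys q"
    have "sv_algebra_act lam (p + q) = x + y"
      using act[of ?S "p + q"] act[of ?S p] act[of ?S q] keys_add[of p q] p q
      by (simp add: lookup_add vec.scale_left_distrib sum.distrib)
    moreover have "p + q \<in> group_algebra"
      using p(1) q(1) keys_add[of p q] by (auto simp: group_algebra_def)
    ultimately show ?thesis unfolding FG_orbit_def by (metis imageI)
  qed
  moreover have "c *s sv_act lam g \<in> FG_orbit lam" if "g \<in> carrier GL" for c g
  proof -
    have "sv_algebra_act lam (Poly_Mapping.single g c) = c *s sv_act lam g"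
      by (cases "c = 0") (auto simp: sv_algebra_act_def)
    moreover have "Poly_Mapping.single g c \<in> group_algebra"
      using that by (auto simp: group_algebra_def)
    ultimately show ?thesis unfolding FG_orbit_def by (metis imageI)
  qed
  ultimately have step: "c *s x + y \<in> FG_orbit lam"
    if "x \<in> sv_act lam ` carrier GL" "y \<in> FG_orbit lam" for c x y
    using that by blast
  show "vec.span (sv_act lam ` carrier GL) \<subseteq> FG_orbit lam"
  proof
    fix z assume "z \<in> vec.span (sv_act lam ` carrier GL)"
    thus "z \<in> FG_orbit lam"
      by (induction rule: vec.span_induct_alt) (simp_all add: zero step)
  qed
qed

lemma U_closed:
  "0 \<in> U_mod" "x \<in> U_mod \<Longrightarrow> y \<in> U_mod \<Longrightarrow> x + y \<in> U_mod" "x \<in> U_mod \<Longrightarrow> c *s x \<in> U_mod"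
  by (auto simp: U_mod_def K_mod_def T_mod_def alg_prod_linear_sv matrix_def trace_def sum.distrib
     simp flip: sum_distrib_left)

lemma U_act:
  assumes "x \<in> U_mod" "g \<in> carrier GL" shows "sv_act x g \<in> U_mod"
proof -
  have inv: "g ** matrix_inv g = mat 1" using assms(2) by (simp add: GL_def matrix_inv_r)
  have conj: "matrix (alg_prod (sv_act x g) u) = matrix_inv g ** matrix (alg_prod x (g *v u)) ** g" for u
  proof -
    have L: "Vector_Spaces.linear (*s) (*s) (alg_prod y w)" for y :: "('a,'b) svec" and w
      by unfold_locales (simp_all add: alg_prod_bilinear)
    have e: "alg_prod (sv_act x g) u v = (matrix_inv g ** matrix (alg_prod x (g *v u)) ** g) *v v" for v
      by (simp add: alg_prod_sv_act matrix_works[OF L] flip: matrix_vector_mul_assoc)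
    show ?thesis by (simp add: matrix_eq matrix_works[OF L] e)
  qed
  then have "trace (matrix (alg_prod (sv_act x g) u)) = trace (matrix (alg_prod x (g *v u)))" for u
  proof -
    let ?A = "matrix (alg_prod x (g *v u))"
    have "trace (matrix_inv g ** ?A ** g) = trace (g ** (matrix_inv g ** ?A))"
      by (rule trace_mul_sym)
    thus ?thesis
      by (simp add: conj matrix_mul_assoc inv)
  qed
  thus ?thesis using assms(1) by (auto simp: U_mod_def K_mod_def T_mod_def alg_prod_sv_act)
qed

lemma M_act:
  assumes "x \<in> M_star" "g \<in> carrier GL" shows "sv_act x g \<in> M_star"
proof -
  have inv: "matrix_inv g ** g = mat 1" using assms(2)
    by (simp add: GL_def matrix_inv_r matrix_left_right_inverse)
  have "matrix_inv g *v alg_prod x (g *v u) (g *v v) \<in> vec.span {u, v}" for u v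
  proof -
    have "matrix_inv g *v alg_prod x (g *v u) (g *v v) \<in> (*v) (matrix_inv g) ` vec.span {g *v u, g *v v}"
      using assms(1) by (auto simp: M_star_def)
    also have "\<dots> = vec.span {u, v}"
      by (subst vec.span_image[symmetric]) (simp add: matrix_vector_mul_assoc inv)
    finally show ?thesis .
  qed
  thus ?thesis by (auto simp: M_star_def alg_prod_sv_act)
qed

lemma M_closed:
  "0 \<in> M_star" "x \<in> M_star \<Longrightarrow> y \<in> M_star \<Longrightarrow> x + y \<in> M_star" "x \<in> M_star \<Longrightarrow> c *s x \<in> M_star"
  by (auto simp: M_star_def alg_prod_linear_sv vec.span_zero vec.span_add vec.span_scale)

lemma field_scalar: "field (scalar_ring :: 'a::field ring)"
proof -
  have "\<exists>y. x + y = 0 \<and> y + x = 0" for x :: 'a by (metis add.commute add.right_inverse)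
  moreover have "\<exists>y. x * y = 1 \<and> y * x = 1" if "x \<noteq> 0" for x :: 'a
    using that by (metis mult.commute right_inverse)
  ultimately show ?thesis
    by unfold_locales (auto simp: scalar_ring_def algebra_simps Units_def)
qed

lemma quotient_is_gmodule:
  "right_gmodule (scalar_ring :: 'a::field ring) GL
     (quotient_gmodule (sv_gmodule (U_mod :: ('a, 'n::finite) svec set)) (U_mod \<inter> M_star))"
proof -
  let ?U = "U_mod :: ('a, 'n::finite) svec set"
  let ?N = "?U \<inter> M_star"
  let ?M = "sv_gmodule ?U"
  define Q where "Q x = (\<lambda>n. n + x) ` ?N" for x
  have N0: "0 \<in> ?N" using U_closed M_closed by auto
  have Nadd: "x + y \<in> ?N" if "x \<in> ?N" "y \<in> ?N" for x y using that U_closed M_closed by auto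
  have Nsc: "c *s x \<in> ?N" if "x \<in> ?N" for x c using that U_closed M_closed by auto
  have Nneg: "- x \<in> ?N" if "x \<in> ?N" for x using Nsc[OF that, of "-1"] by simp
  have Nact: "sv_act x g \<in> ?N" if "x \<in> ?N" "g \<in> carrier GL" for x g using that U_act M_act by auto
  have Qeq: "Q x = Q y" if "x - y \<in> ?N" for x y
  proof -
    have "Q x \<subseteq> Q y" if "x - y \<in> ?N" for x y
    proof
      fix z assume "z \<in> Q x"
      then obtain n where n: "n \<in> ?N" "z = n + x" by (auto simp: Q_def)
      have "n + (x - y) \<in> ?N" using Nadd n that by blast
      thus "z \<in> Q y" using n unfolding Q_def by (intro image_eqI[of _ _ "n + (x - y)"]) auto
    qed
    from this[OF that] this[of y x] Nneg[OF that] show ?thesis by auto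
  qed
  have coset: "?N +>\<^bsub>?M\<^esub> x = Q x" for x
    by (auto simp: a_r_coset_def r_coset_def sv_gmodule_def Q_def)
  let ?Q = "quotient_gmodule ?M ?N"
  have car: "carrier ?Q = Q ` ?U"
    by (auto simp: quotient_gmodule_def A_RCOSETS_def RCOSETS_def sv_gmodule_def Q_def r_coset_def)
  have zero: "\<zero>\<^bsub>?Q\<^esub> = Q 0" by (simp add: quotient_gmodule_def Q_def)
  have add: "Q x \<oplus>\<^bsub>?Q\<^esub> Q y = Q (x + y)" for x y
  proof -
    have "Q x \<oplus>\<^bsub>?Q\<^esub> Q y = {a + b | a b. a \<in> Q x \<and> b \<in> Q y}"
      by (auto simp: quotient_gmodule_def set_add_def set_mult_def sv_gmodule_def)
    also have "\<dots> = Q (x + y)"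
    proof (intro equalityI subsetI)
      fix z assume "z \<in> {a + b | a b. a \<in> Q x \<and> b \<in> Q y}"
      then obtain n m where "n \<in> ?N" "m \<in> ?N" "z = n + x + (m + y)" by (auto simp: Q_def)
      thus "z \<in> Q (x + y)" unfolding Q_def
        by (intro image_eqI[of _ _ "n + m"]) (use Nadd in \<open>auto simp: algebra_simps\<close>)
    next
      fix z assume "z \<in> Q (x + y)"
      then obtain n where "n \<in> ?N" "z = (n + x) + (0 + y)" by (auto simp: Q_def algebra_simps)
      thus "z \<in> {a + b | a b. a \<in> Q x \<and> b \<in> Q y}" using N0 unfolding Q_def by blast
    qed
    finally show ?thesis .
  qed
  have self: "x \<in> Q x" for x using N0 by (force simp: Q_def)
  have sc: "c \<odot>\<^bsub>?Q\<^esub> Q x = Q (c *s x)" for c x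
  proof -
    have "Q (c *s y) = Q (c *s x)" if "y \<in> Q x" for y
      using that by (intro Qeq) (auto simp: Q_def vec.scale_right_distrib intro: Nsc[THEN IntD1] Nsc[THEN IntD2])
    moreover have "c \<odot>\<^bsub>?Q\<^esub> Q x = (\<Union>y\<in>Q x. Q (c *s y))"
      using coset by (simp add: quotient_gmodule_def sv_gmodule_def)
    ultimately show ?thesis using self by blast
  qed
  have ac: "act ?Q (Q x) g = Q (sv_act x g)" if "g \<in> carrier GL" for x g
  proof -
    have "Q (sv_act y g) = Q (sv_act x g)" if "y \<in> Q x" for y
      using that \<open>g \<in> _\<close>
      by (intro Qeq) (auto simp: Q_def sv_act_linear intro: Nact[THEN IntD1] Nact[THEN IntD2])
    moreover have "act ?Q (Q x) g = (\<Union>y\<in>Q x. Q (sv_act y g))"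
      using coset by (simp add: quotient_gmodule_def sv_gmodule_def)
    ultimately show ?thesis using self by blast
  qed
  note calc = car zero add sc ac
  interpret F: field "scalar_ring :: 'a ring" by (rule field_scalar)
  interpret G: group "GL :: ('a ^ 'n ^ 'n) monoid" by (rule group_GL)
  have inv: "\<exists>y\<in>?U. Q (y + x) = Q 0" if "x \<in> ?U" for x
    using U_closed(3)[OF that, of "-1"] by (intro bexI[of _ "-x"]) auto
  have ac3: "Q (x + y + z) = Q (x + (y + z))" "Q (z + (x + y)) = Q (x + (y + z))" for x y z by (simp_all add: algebra_simps)
  have ac4: "Q (x + y) = Q (y + x)" for x y by (simp add: add.commute)
  have inv2: "\<exists>y\<in>?U. Q (x + y) = Q 0" if "x \<in> ?U" for x using inv[OF that] ac4 by metis
  have "abelian_group ?Q"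
    by (rule abelian_groupI) (auto simp: calc U_closed(1,2) inv inv2 ac3(1) ac4, use ac3 in auto)
  then have "Module.module (scalar_ring :: 'a ring) ?Q"
    by (intro moduleI F.is_cring)
      (auto simp: calc U_closed scalar_ring_def vec.scale_left_distrib vec.scale_right_distrib)
  moreover have "right_gmodule_axioms (scalar_ring :: 'a ring) GL ?Q"
  proof (rule right_gmodule_axioms.intro)
    fix x assume "x \<in> carrier ?Q"
    thus "act ?Q x \<one>\<^bsub>GL\<^esub> = x"
      using ac[OF G.one_closed] by (auto simp: car) (auto simp: GL_def sv_act_one)
  next
    fix x and g h :: "'a ^ 'n ^ 'n"
    assume x: "x \<in> carrier ?Q" and gh: "g \<in> carrier GL" "h \<in> carrier GL"
    have "sv_act y (g \<otimes>\<^bsub>GL\<^esub> h) = sv_act (sv_act y g) h" for y :: "('a, 'n) svec"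
      using gh by (simp add: GL_def sv_act_mult)
    thus "act ?Q x (g \<otimes>\<^bsub>GL\<^esub> h) = act ?Q (act ?Q x g) h"
      using x gh G.m_closed[OF gh] by (auto simp: car ac)
  qed (auto simp: field_scalar calc U_act sv_act_linear)
  ultimately show ?thesis
    by (intro right_gmodule.intro G.is_group)
qed

end

theory Submission
  imports Defs
begin

text \<open>
  A transvection \<open>g\<^sub>s = 1 + s (a \<otimes> h)\<close>, with \<open>h\<close> a linear form vanishing at \<open>a\<close>, turns
  \<open>\<lambda> \<in> \<M>\<^sup>*\<^sup>*\<close> into \<open>\<lambda> + s X + s\<^sup>2 Y\<close> where \<open>Y = f \<and> h \<otimes> a\<close> and \<open>f = h([a, _])\<close>.  As \<open>|\<F>| > 2\<close>
  there is a scalar \<open>t\<close> other than \<open>0\<close> and \<open>1\<close>, and \<open>\<lambda>g\<^sub>t - t \<lambda>g\<^sub>1 + (t - 1)\<lambda> = (t\<^sup>2 - t) Y\<close>.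
  If \<open>\<lambda> \<notin> \<M>\<^sup>*\<close>, then \<open>a\<close> and \<open>h\<close> can be chosen such that \<open>f\<close> and \<open>h\<close> are independent, and
  \<open>Y\<close> lies in the orbit of \<open>\<eta>\<close>.  Finally \<open>\<eta>\<close> generates \<open>\<U>\<close>, and irreducibility follows since
  \<open>\<U> \<subseteq> \<M>\<^sup>*\<^sup>*\<close>.
\<close>

text \<open>The complements of \<open>A\<close> and of its image have equal size, so any bijection
  between them completes \<open>f\<close>. This serves both permutations of indices and completions
  to a basis.\<close>

lemma bij_betw_extend:
  assumes fin: "finite X" "finite Y" and card: "card X = card Y"
    and A: "A \<subseteq> X" "inj_on f A" "f ` A \<subseteq> Y"
  obtains p where "bij_betw p X Y" "\<And>x. x \<in> A \<Longrightarrow> p x = f x"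
proof -
  have "card (X - A) = card (Y - f ` A)"
    using fin A card by (simp add: card_Diff_subset finite_subset card_image)
  then obtain q where q: "bij_betw q (X - A) (Y - f ` A)"
    using finite_same_card_bij fin by (meson finite_Diff)
  define p where "p x = (if x \<in> A then f x else q x)" for x
  have "bij_betw p A (f ` A)"
    using A(2) by (auto simp: p_def bij_betw_def inj_on_def)
  moreover have "bij_betw p (X - A) (Y - f ` A)"
    using q by (subst bij_betw_cong[where g = q]) (auto simp: p_def)
  ultimately have "bij_betw p (A \<union> (X - A)) (f ` A \<union> (Y - f ` A))"
    by (rule bij_betw_combine) auto
  moreover have "A \<union> (X - A) = X" "f ` A \<union> (Y - f ` A) = Y" using A by auto
  ultimately show ?thesis using that by (auto simp: p_def)
qed


section \<open>Invertible matrices\<close>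

lemma matrix_inv_mult_vec:
  fixes g :: "'a::field ^ 'n::finite ^ 'n"
  assumes "invertible g" and "g *v x = y"
  shows "matrix_inv g *v y = x"
proof -
  have "matrix_inv g ** g = mat 1"
    using assms by (simp add: matrix_inv_r matrix_left_right_inverse)
  then show ?thesis
    by (simp add: assms(2)[symmetric] matrix_vector_mul_assoc)
qed

lemma transvection:
  fixes h :: "'a::field ^ 'n::finite \<Rightarrow> 'a"
  assumes h: "Vector_Spaces.linear (*s) (*) h" and "h a = 0"
  obtains g where "invertible g" "\<And>x. g *v x = x + h x *s a"
    "\<And>x. matrix_inv g *v x = x - h x *s a"
proof -
  interpret h: Vector_Spaces.linear "(*s)" "(*)" h by (rule h)
  define g where "g = matrix (\<lambda>x. x + h x *s a)"
  define g' where "g' = matrix (\<lambda>x. x - h x *s a)"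
  have g: "g *v x = x + h x *s a" for x
    unfolding g_def by (rule matrix_works, unfold_locales)
      (simp_all add: h.add h.scale algebra_simps vec.scale_left_distrib)
  have g': "g' *v x = x - h x *s a" for x
    unfolding g'_def by (rule matrix_works, unfold_locales)
      (simp_all add: h.add h.scale algebra_simps vec.scale_left_distrib)
  have "g ** g' = mat 1"
    unfolding matrix_eq
    by (simp add: g g' h.diff h.scale assms(2) flip: matrix_vector_mul_assoc)
  then have "invertible g" "matrix_inv g = g'"
    by (auto simp: invertible_def matrix_left_right_inverse intro!: matrix_invI)
  with g g' that show ?thesis by blast
qed

text \<open>The two formulas are what the action on \<open>f \<and> h \<otimes> w\<close> calls for:
  coordinate forms and basis vectors are both relabelled by \<open>p\<close>.\<close>

lemma permutation_matrix:
  fixes p :: "'n::finite \<Rightarrow> 'n"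
  assumes "bij p"
  obtains g :: "'a::field ^ 'n ^ 'n" where "invertible g" "\<And>x i. (g *v x) $ i = x $ p i"
    "\<And>i. matrix_inv g *v axis i 1 = axis (p i) 1"
proof -
  define g :: "'a ^ 'n ^ 'n" where "g = matrix (\<lambda>x. \<chi> i. x $ p i)"
  define g' :: "'a ^ 'n ^ 'n" where "g' = matrix (\<lambda>x. \<chi> i. x $ inv_into UNIV p i)"
  have g: "(g *v x) $ i = x $ p i" for x i
  proof -
    have "g *v x = (\<chi> i. x $ p i)"
      unfolding g_def by (rule matrix_works, unfold_locales) (simp_all add: vec_eq_iff)
    then show ?thesis by simp
  qed
  have g': "(g' *v x) $ i = x $ inv_into UNIV p i" for x i
  proof -
    have "g' *v x = (\<chi> i. x $ inv_into UNIV p i)"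
      unfolding g'_def by (rule matrix_works, unfold_locales) (simp_all add: vec_eq_iff)
    then show ?thesis by simp
  qed
  have "g ** g' = mat 1"
    unfolding matrix_eq
    by (simp add: vec_eq_iff g g' bij_is_inj[OF assms] flip: matrix_vector_mul_assoc)
  then have inv: "invertible g"
    by (auto simp: invertible_def matrix_left_right_inverse)
  have "g *v axis (p i) 1 = axis i 1" for i
    using bij_is_inj[OF assms] by (auto simp: vec_eq_iff g axis_def inj_eq)
  then show ?thesis
    using that[OF inv] g matrix_inv_mult_vec[OF inv] by blast
qed

text \<open>Complete \<open>B\<close> to a basis and use it as the set of columns, with
  \<open>f i\<close> in column \<open>i\<close> for \<open>i \<in> A\<close>; the range then
  contains a basis.\<close>

lemma independent_imp_columns:
  fixes B :: "('a::field ^ 'n::finite) set"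
  assumes B: "vec.independent B" and f: "inj_on f A" "f ` A \<subseteq> B"
  obtains g :: "'a ^ 'n ^ 'n" where "invertible g" "\<And>i. i \<in> A \<Longrightarrow> g *v axis i 1 = f i"
proof -
  define C where "C = vec.extend_basis B"
  have C: "B \<subseteq> C" "vec.independent C" "vec.span C = UNIV"
    unfolding C_def using B
    by (simp_all add: vec.extend_basis_superset vec.independent_extend_basis)
  have finC: "finite C" using C(2) by (rule vec.finiteI_independent)
  have "card C = vec.dim (UNIV :: ('a ^ 'n) set)"
    using vec.dim_eq_card[of C UNIV] C by simp
  then have "card (UNIV :: 'n set) = card C" by (simp add: vec.dim_UNIV card_cart_basis)
  then obtain p where p: "bij_betw p UNIV C" "\<And>i. i \<in> A \<Longrightarrow> p i = f i"
    using bij_betw_extend[of UNIV C A f] finC f C(1) by auto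
  define g :: "'a ^ 'n ^ 'n" where "g = (\<chi> i j. p j $ i)"
  have g: "g *v axis j 1 = p j" for j
    by (simp add: matrix_vector_mul_component vec_eq_iff matrix_vector_mult_def g_def axis_def
        if_distrib cong: if_cong)
  have "range ((*v) g) = UNIV"
  proof -
    have "C \<subseteq> range ((*v) g)" using p(1) g by (metis bij_betw_imp_surj_on image_subset_iff rangeI)
    moreover have "vec.subspace (range ((*v) g))"
      by (intro vec.subspace_image vec.subspace_UNIV)
    ultimately have "vec.span C \<subseteq> range ((*v) g)" by (rule vec.span_minimal)
    then show ?thesis using C(3) by auto
  qed
  then have "invertible g"
    by (metis invertible_def matrix_left_right_inverse matrix_right_invertible_surjective)
  then show ?thesis using that g p(2) by metis
qed


section \<open>Submodules of the space of structure vectors\<close>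

text \<open>A record-free form of G-submodule, in which all generation arguments run; only the
  quotient uses the record version.\<close>

definition sv_submodule :: "('a::field, 'n::finite) svec set \<Rightarrow> bool" where
  "sv_submodule S \<longleftrightarrow>
     vec.subspace S \<and> (\<forall>x\<in>S. \<forall>g. invertible g \<longrightarrow> sv_act x g \<in> S)"

lemma sv_submoduleD:
  assumes "sv_submodule S"
  shows "0 \<in> S" "x \<in> S \<Longrightarrow> y \<in> S \<Longrightarrow> x + y \<in> S" "x \<in> S \<Longrightarrow> y \<in> S \<Longrightarrow> x - y \<in> S"
    "x \<in> S \<Longrightarrow> c *s x \<in> S" "x \<in> S \<Longrightarrow> invertible g \<Longrightarrow> sv_act x g \<in> S"
  using assms
  by (auto simp: sv_submodule_def vec.subspace_0 vec.subspace_add vec.subspace_diff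
      vec.subspace_scale)

text \<open>Acting by \<open>g\<close> on \<open>sv_act lam k\<close> gives
  \<open>sv_act lam (k ** g)\<close>, so the group maps the spanning set into itself.\<close>

lemma sv_submodule_FG_orbit: "sv_submodule (FG_orbit lam)"
  unfolding sv_submodule_def
proof (intro conjI ballI allI impI)
  show "vec.subspace (FG_orbit lam)" by (simp add: FG_orbit_eq_span vec.subspace_span)
  fix x and g :: "'a ^ 'b ^ 'b" assume x: "x \<in> FG_orbit lam" and g: "invertible g"
  have "x \<in> vec.span (sv_act lam ` carrier GL)" using x by (simp add: FG_orbit_eq_span)
  then show "sv_act x g \<in> FG_orbit lam"
    unfolding FG_orbit_eq_span
  proof (induction rule: vec.span_induct_alt)
    case base
    have "sv_act (0 :: ('a, 'b) svec) g = 0" using sv_act_linear(2)[of 0 0 g] by simp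
    then show ?case by (simp add: vec.span_zero)
  next
    case (step c y z)
    then obtain k where k: "invertible k" "y = sv_act lam k" by (auto simp: GL_def)
    then have "sv_act y g = sv_act lam (k ** g)" using g by (simp add: sv_act_mult)
    moreover have "invertible (k ** g)" using k g by (simp add: invertible_mult)
    ultimately have "sv_act y g \<in> sv_act lam ` carrier GL" by (auto simp: GL_def)
    then show ?case
      using step.IH by (simp add: sv_act_linear vec.span_add vec.span_scale vec.span_base)
  qed
qed

lemma FG_orbit_self: "lam \<in> FG_orbit lam"
proof -
  have "lam = sv_act lam (mat 1)" by (simp add: sv_act_one)
  moreover have "mat 1 \<in> carrier GL" by (auto simp: GL_def invertible_def intro: exI[of _ "mat 1"])
  ultimately show ?thesis unfolding FG_orbit_eq_span by (metis imageI vec.span_base)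
qed

lemma FG_orbit_subset:
  assumes "sv_submodule S" "lam \<in> S" shows "FG_orbit lam \<subseteq> S"
  unfolding FG_orbit_eq_span
  using assms by (intro vec.span_minimal) (auto simp: sv_submodule_def GL_def)


section \<open>Decomposable structure vectors\<close>

text \<open>\<open>tri f h w\<close> is \<open>f \<and> h \<otimes> w\<close>.\<close>

definition tri ::
  "('a::field ^ 'n::finite \<Rightarrow> 'a) \<Rightarrow> ('a ^ 'n \<Rightarrow> 'a) \<Rightarrow> 'a ^ 'n \<Rightarrow> ('a, 'n) svec" where
  "tri f h w = structure_vector (\<lambda>u v. (f u * h v - f v * h u) *s w)"

lemma alg_prod_tri:
  assumes "Vector_Spaces.linear (*s) (*) f" "Vector_Spaces.linear (*s) (*) h"
  shows "alg_prod (tri f h w) u v = (f u * h v - f v * h u) *s w"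
proof -
  interpret f: Vector_Spaces.linear "(*s)" "(*)" f by fact
  interpret h: Vector_Spaces.linear "(*s)" "(*)" h by fact
  show ?thesis
    unfolding tri_def
    by (rule alg_prod_structure_vector; unfold_locales)
      (simp_all add: vec_eq_iff f.add f.scale h.add h.scale algebra_simps)
qed

lemma linear_component: "Vector_Spaces.linear (*s) (*) (\<lambda>x :: 'a::field ^ 'n::finite. x $ i)"
  by unfold_locales (simp_all add: algebra_simps)

lemma linear_comp_matrix:
  fixes f :: "'a::field ^ 'n::finite \<Rightarrow> 'a"
  assumes "Vector_Spaces.linear (*s) (*) f"
  shows "Vector_Spaces.linear (*s) (*) (\<lambda>x. f (g *v x))"
proof -
  interpret f: Vector_Spaces.linear "(*s)" "(*)" f by fact
  show ?thesis by unfold_locales (simp_all add: vec.add vec.scale f.add f.scale)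
qed

lemma sv_act_tri:
  assumes "Vector_Spaces.linear (*s) (*) f" "Vector_Spaces.linear (*s) (*) h"
  shows "sv_act (tri f h w) g
    = tri (\<lambda>x. f (g *v x)) (\<lambda>x. h (g *v x)) (matrix_inv g *v w)"
  by (rule svec_eqI)
    (simp add: alg_prod_sv_act alg_prod_tri assms linear_comp_matrix vec.scale vec.diff)

text \<open>For distinct indices this is \<open>eta\<close> up to renaming the basis vectors; the
  case \<open>k = j\<close> occurs in the trace-zero differences below.\<close>

abbreviation unit_tri :: "'n::finite \<Rightarrow> 'n \<Rightarrow> 'n \<Rightarrow> ('a::field, 'n) svec" where
  "unit_tri i j k \<equiv> tri (\<lambda>x. x $ i) (\<lambda>x. x $ j) (axis k 1)"

lemma unit_tri_component:
  "unit_tri i j k $ (x, y, z) =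
    (of_bool (x = i \<and> y = j \<and> z = k) - of_bool (x = j \<and> y = i \<and> z = k) :: 'a::field)"
  by (auto simp: tri_def structure_vector_def axis_def)

lemma unit_tri_permute:
  assumes S: "sv_submodule S" and mem: "unit_tri i j k \<in> S"
    and "distinct [i, j, k]" "distinct [i', j', k']"
  shows "unit_tri i' j' k' \<in> S"
proof -
  define f where "f = (\<lambda>x. if x = i then i' else if x = j then j' else k')"
  obtain p where p: "bij p" "\<And>x. x \<in> {i, j, k} \<Longrightarrow> p x = f x"
    by (rule bij_betw_extend[of UNIV UNIV "{i, j, k}" f])
      (use assms(3,4) in \<open>auto simp: inj_on_def f_def split: if_splits\<close>)
  obtain g where g: "invertible g" "\<And>(x :: 'a ^ 'b) i. (g *v x) $ i = x $ p i"
    "\<And>i. matrix_inv g *v axis i 1 = axis (p i) (1 :: 'a)"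
    using permutation_matrix[OF p(1)] by metis
  have "p i = i'" "p j = j'" "p k = k'" using p(2) assms(3) by (auto simp: f_def)
  then have "sv_act (unit_tri i j k) g = unit_tri i' j' k'"
    by (simp add: sv_act_tri linear_component g)
  with sv_submoduleD(5)[OF S mem g(1)] show ?thesis by simp
qed

text \<open>Subtracting \<open>x $ k\<close> from coordinate \<open>j\<close> turns the form
  \<open>x $ j\<close> into \<open>x $ j - x $ k\<close>, while the inverse sends
  \<open>axis k 1\<close> to \<open>axis k 1 + axis j 1\<close>. Expanding the product gives the
  wanted difference plus two terms with distinct indices.\<close>

lemma unit_tri_diff_mem:
  assumes S: "sv_submodule S" and mem: "\<And>i j k. distinct [i, j, k] \<Longrightarrow> unit_tri i j k \<in> S"
    and ijk: "distinct [i, j, k]"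
  shows "unit_tri i j j - unit_tri i k k \<in> S"
proof -
  have lin: "Vector_Spaces.linear (*s) (*) (\<lambda>x :: 'a ^ 'b. - (x $ k))"
    by unfold_locales (simp_all add: algebra_simps)
  have "- (axis j (1 :: 'a) $ k) = 0" using ijk by (auto simp: axis_def)
  with lin obtain g where g: "invertible g" "\<And>x :: 'a ^ 'b. g *v x = x + (- (x $ k)) *s axis j 1"
    "\<And>x :: 'a ^ 'b. matrix_inv g *v x = x - (- (x $ k)) *s axis j 1"
    by (rule transvection) blast
  have "sv_act (unit_tri i j k) g
      = unit_tri i j j - unit_tri i k k + unit_tri i j k - unit_tri i k j"
    unfolding sv_act_tri[OF linear_component linear_component] g(2,3)
    using ijk
    by (auto simp: vec_eq_iff tri_def structure_vector_def axis_def)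
  moreover have "sv_act (unit_tri i j k) g \<in> S" "unit_tri i j k \<in> S" "unit_tri i k j \<in> S"
    using mem ijk g(1) sv_submoduleD(5)[OF S] by auto
  moreover have "unit_tri i j j - unit_tri i k k
      = sv_act (unit_tri i j k) g - unit_tri i j k + unit_tri i k j"
    using calculation(1) by simp
  ultimately show ?thesis using sv_submoduleD(2,3)[OF S] by metis
qed

section \<open>Generators of \<open>U_mod\<close>\<close>

lemma K_mod_component:
  assumes "x \<in> K_mod"
  shows "x $ (i, i, k) = 0" "x $ (j, i, k) = - x $ (i, j, k)"
proof -
  have diag: "alg_prod x v v = 0" for v using assms by (simp add: K_mod_def)
  show "x $ (i, i, k) = 0" using diag by (simp flip: alg_prod_axis)
  have "alg_prod x (axis i 1 + axis j 1) (axis i 1 + axis j 1) = 0" by (rule diag)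
  then have "alg_prod x (axis i 1) (axis j 1) + alg_prod x (axis j 1) (axis i 1) = 0"
    by (simp add: alg_prod_bilinear diag add.commute)
  then show "x $ (j, i, k) = - x $ (i, j, k)"
    by (simp add: eq_neg_iff_add_eq_0 add.commute flip: alg_prod_axis vector_add_component)
qed

lemma T_mod_component:
  assumes "x \<in> T_mod" shows "(\<Sum>j\<in>UNIV. x $ (i, j, j)) = 0"
proof -
  have "trace (matrix (alg_prod x (axis i 1))) = 0" using assms by (simp add: T_mod_def)
  then show ?thesis by (simp add: trace_def matrix_def alg_prod_axis)
qed

text \<open>The trace of \<open>v \<mapsto> (f u * h v - f v * h u) *s w\<close> is
  \<open>f u * h w - f w * h u\<close>, and here both forms vanish at
  \<open>w = axis k 1\<close>.\<close>

lemma unit_tri_in_U_mod: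
  assumes "distinct [i, j, k]" shows "unit_tri i j k \<in> U_mod"
proof -
  have "trace (matrix (alg_prod (unit_tri i j k) u)) = 0" for u :: "'b ^ 'a"
    unfolding trace_def matrix_def
    using assms by (auto simp: alg_prod_tri linear_component axis_def intro!: sum.neutral)
  then show ?thesis
    by (simp add: U_mod_def K_mod_def T_mod_def alg_prod_tri linear_component)
qed

lemma sv_submodule_U_mod: "sv_submodule U_mod"
  unfolding sv_submodule_def vec.subspace_def
  by (auto simp: U_closed U_act GL_def)

text \<open>Induction on the number of nonzero structure constants: each step subtracts a multiple
  of a \<open>unit_tri\<close> with distinct indices, or of a trace-zero difference of two
  others.\<close>

lemma U_mod_subset_submodule:
  assumes S: "sv_submodule S" and mem: "\<And>i j k. distinct [i, j, k] \<Longrightarrow> unit_tri i j k \<in> S"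
  shows "U_mod \<subseteq> S"
proof
  fix x :: "('a, 'b) svec" assume "x \<in> U_mod"
  then show "x \<in> S"
  proof (induction "card {t. x $ t \<noteq> 0}" arbitrary: x rule: less_induct)
    case less
    have K: "x \<in> K_mod" and T: "x \<in> T_mod" using less.prems by (auto simp: U_mod_def)
    have reduce: "x \<in> S"
      if y: "y \<in> S" "y \<in> U_mod" "{t. (x - c *s y) $ t \<noteq> 0} \<subset> {t. x $ t \<noteq> 0}" for y c
    proof -
      have "x - c *s y \<in> S"
        by (rule less.hyps[OF psubset_card_mono[OF _ y(3)]])
          (auto intro!: sv_submoduleD(3,4)[OF sv_submodule_U_mod] y(2) less.prems)
      then have "x - c *s y + c *s y \<in> S" using y(1) sv_submoduleD[OF S] by blast
      then show ?thesis by simp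
    qed
    \<comment> \<open>Entries at \<open>(i, i, k)\<close> vanish and an entry at
      \<open>(i, j, i)\<close> is minus the one at \<open>(j, i, i)\<close>, so these cases are
      exhaustive.\<close>
    consider (3) i j k where "distinct [i, j, k]" "x $ (i, j, k) \<noteq> 0"
      | (2) i j where "i \<noteq> j" "x $ (i, j, j) \<noteq> 0"
      | (0) "\<forall>i j k. x $ (i, j, k) = 0"
      using K_mod_component[OF K] by (metis distinct_length_2_or_more distinct_singleton neg_equal_0_iff_equal)
    then show ?case
    proof cases
      case 3
      define c where "c = x $ (i, j, k)"
      \<comment> \<open>By antisymmetry the entry at \<open>(j, i, k)\<close> is nonzero too, so the
        support does not grow.\<close>
      have "(x - c *s unit_tri i j k) $ (u, v, w) = 0" if "x $ (u, v, w) = 0" for u v w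
        using that 3 K_mod_component(2)[OF K, of j i k]
        by (auto simp: unit_tri_component c_def)
      moreover have "(x - c *s unit_tri i j k) $ (i, j, k) = 0"
        using 3 by (auto simp: unit_tri_component c_def)
      ultimately have "{t. (x - c *s unit_tri i j k) $ t \<noteq> 0} \<subset> {t. x $ t \<noteq> 0}"
        using 3(2) by (intro psubsetI subsetI) auto
      then show ?thesis by (rule reduce[OF mem[OF 3(1)] unit_tri_in_U_mod[OF 3(1)]])
    next
      case 2
      \<comment> \<open>Trace zero forbids a single nonzero summand, so a second one is available to
        compensate.\<close>
      have "\<exists>l\<in>UNIV - {j}. x $ (i, l, l) \<noteq> 0"
      proof (rule ccontr)
        assume "\<not> ?thesis"
        then have "(\<Sum>l\<in>UNIV. x $ (i, l, l)) = x $ (i, j, j)"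
          by (subst sum.remove[of UNIV j]) auto
        then show False using T_mod_component[OF T, of i] 2 by simp
      qed
      then obtain l where l: "l \<noteq> j" "x $ (i, l, l) \<noteq> 0" by auto
      then have "l \<noteq> i" using K_mod_component(1)[OF K] by auto
      with l 2 have d: "distinct [i, j, l]" by auto
      define c where "c = x $ (i, j, j)"
      define y :: "('a, 'b) svec" where "y = unit_tri i j j - unit_tri i l l"
      have "y \<in> S" "y \<in> U_mod"
        unfolding y_def
        using unit_tri_diff_mem[OF S mem d]
          unit_tri_diff_mem[OF sv_submodule_U_mod unit_tri_in_U_mod d] by auto
      moreover have "(x - c *s y) $ (u, v, w) = 0" if "x $ (u, v, w) = 0" for u v w
        using that 2 l K_mod_component(2)[OF K, of j i j] K_mod_component(2)[OF K, of l i l]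
        by (auto simp: unit_tri_component c_def y_def)
      moreover have "(x - c *s y) $ (i, j, j) = 0"
        using 2 l by (auto simp: unit_tri_component c_def y_def)
      ultimately show ?thesis
        using 2(2) by (intro reduce[of y c] psubsetI subsetI) auto
    next
      case 0
      then have "x = 0" by (auto simp: vec_eq_iff)
      then show ?thesis using sv_submoduleD(1)[OF S] by simp
    qed
  qed
qed


section \<open>Extracting a decomposable structure vector\<close>

text \<open>Write \<open>[v,v] = e(v) v\<close> and compare both sides at \<open>x + s a\<close>.
  The values \<open>s = 1\<close> and \<open>s = t\<close> together force
  \<open>e (x + a) - e x = p\<close> when \<open>h x \<noteq> 0\<close>; when \<open>h x = 0\<close>
  the value \<open>s = 1\<close> suffices.\<close>

lemma M_star_star_polarize:
  fixes lam :: "('a::field, 'n::finite) svec"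
  assumes lam: "lam \<in> M_star_star" and h: "Vector_Spaces.linear (*s) (*) h"
    and a: "h a = 0" "a \<noteq> 0" "alg_prod lam a a = p *s a"
    and t: "t \<noteq> (0 :: 'a)" "t \<noteq> 1"
  shows "h (alg_prod lam a x) + h (alg_prod lam x a) = p * h x"
proof -
  interpret h: Vector_Spaces.linear "(*s)" "(*)" h by fact
  define B where "B = alg_prod lam x a + alg_prod lam a x"
  have "\<exists>c. alg_prod lam v v = c *s v" for v
    using lam by (auto simp: M_star_star_def vec.span_singleton)
  then obtain e where e: "\<And>v. alg_prod lam v v = e v *s v" by metis
  have quad: "e x *s x + s *s B + (s * s * p) *s a = e (x + s *s a) *s (x + s *s a)" for s
    using e[of "x + s *s a"] e[of x] a(3)
    by (simp add: alg_prod_bilinear B_def vec.scale_right_distrib algebra_simps)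
  have hB: "s * h B = (e (x + s *s a) - e x) * h x" for s
    using arg_cong[OF quad[of s], of h] a(1)
    by (simp add: h.add h.scale algebra_simps)
  have "h B = p * h x"
  proof (cases "h x = 0")
    case True
    then show ?thesis using hB[of 1] by simp
  next
    case False
    define c where "c = e (x + 1 *s a)"
    define d where "d = e (x + t *s a)"
    have B: "B = (c - e x) *s x + (c - p) *s a"
      using quad[of 1] unfolding c_def[symmetric]
      by (simp add: vec.scale_left_diff_distrib vec.scale_right_distrib algebra_simps)
    have "t * ((c - e x) * h x) = (d - e x) * h x"
      using hB[of t] hB[of 1] by (simp add: c_def d_def)
    then have "(t * (c - e x)) * h x = (d - e x) * h x" by (simp only: mult.assoc)
    then have "t * (c - e x) = d - e x" using False by (simp only: mult_cancel_right) simp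
    then have d: "d = e x + t * (c - e x)" by simp
    \<comment> \<open>After inserting \<open>B\<close> and \<open>d\<close> the multiples of
      \<open>x\<close> cancel, leaving a relation on the coefficient of \<open>a\<close>.\<close>
    have "(t * (c - p) + t * t * p - d * t) *s a = 0"
      using quad[of t] unfolding d_def[symmetric] B d
      by (simp add: vec_eq_iff algebra_simps)
    then have "t * (c - p) + t * t * p - d * t = 0"
      using a(2) vec.scale_eq_0_iff by blast
    then have "t * ((1 - t) * (c - e x - p)) = 0" unfolding d by (simp add: algebra_simps)
    then have "c - e x = p" using t by simp
    then show ?thesis using hB[of 1] by (simp add: c_def)
  qed
  then show ?thesis by (simp add: B_def h.add add.commute)
qed

lemma tri_mem_submodule:
  fixes lam :: "('a::field, 'n::finite) svec"
  assumes S: "sv_submodule S" "lam \<in> S"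
    and lam: "lam \<in> M_star_star" and h: "Vector_Spaces.linear (*s) (*) h"
    and a: "h a = 0" "a \<noteq> 0" and t: "t \<noteq> (0 :: 'a)" "t \<noteq> 1"
  shows "tri (\<lambda>x. h (alg_prod lam a x)) h a \<in> S"
proof -
  interpret h: Vector_Spaces.linear "(*s)" "(*)" h by fact
  define f where "f x = h (alg_prod lam a x)" for x
  have f: "Vector_Spaces.linear (*s) (*) f"
    unfolding f_def by unfold_locales (simp_all add: alg_prod_bilinear h.add h.scale)
  obtain p where p: "alg_prod lam a a = p *s a"
    using lam by (auto simp: M_star_star_def vec.span_singleton)
  \<comment> \<open>This trades right multiplication by \<open>a\<close> for left multiplication, so
    the quadratic term below involves only \<open>f\<close> and \<open>h\<close>.\<close>
  have swap: "h (alg_prod lam x a) = p * h x - f x" for x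
    using M_star_star_polarize[OF lam h a p t, of x] by (simp add: f_def eq_diff_eq add.commute)
  have "\<exists>g. invertible g \<and> (\<forall>x. g *v x = x + (s * h x) *s a)
      \<and> (\<forall>x. matrix_inv g *v x = x - (s * h x) *s a)" for s
  proof -
    have "Vector_Spaces.linear (*s) (*) (\<lambda>x. s * h x)"
      by unfold_locales (simp_all add: h.add h.scale algebra_simps)
    from transvection[OF this, of a] a(1) show ?thesis by (metis mult_zero_right)
  qed
  then obtain G where G: "\<And>s. invertible (G s)" "\<And>s x. G s *v x = x + (s * h x) *s a"
    "\<And>s x. matrix_inv (G s) *v x = x - (s * h x) *s a"
    by metis
  \<comment> \<open>\<open>X\<close> is the coefficient of \<open>s\<close>. The cubic term vanishes
    because \<open>h (p *s a) = 0\<close>; in the quadratic term the two contributions of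
    \<open>p\<close> cancel by \<open>swap\<close>, leaving an alternating product.\<close>
  define X where "X u v = h v *s alg_prod lam u a + h u *s alg_prod lam a v
    - h (alg_prod lam u v) *s a" for u v
  have prod: "alg_prod (sv_act lam (G s)) u v
      = alg_prod lam u v + s *s X u v + (s * s) *s alg_prod (tri f h a) u v" for s u v
    unfolding alg_prod_sv_act G(2,3) alg_prod_bilinear alg_prod_tri[OF f h] X_def p
    by (simp add: h.add h.scale swap a(1) flip: f_def)
      (simp add: vec_eq_iff algebra_simps)
  have "sv_act lam (G t) - t *s sv_act lam (G 1) + (t - 1) *s lam = (t * t - t) *s tri f h a"
  proof (rule svec_eqI)
    have diff: "alg_prod (x - y) u v = alg_prod x u v - alg_prod y u v"
      for x y :: "('a, 'n) svec" and u v
      using alg_prod_linear_sv(2)[of "x - y" y u v] by simp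
    show "alg_prod (sv_act lam (G t) - t *s sv_act lam (G 1) + (t - 1) *s lam) u v
        = alg_prod ((t * t - t) *s tri f h a) u v" for u v
      unfolding alg_prod_linear_sv diff prod
      by (simp add: vec_eq_iff algebra_simps)
  qed
  moreover have "sv_act lam (G t) - t *s sv_act lam (G 1) + (t - 1) *s lam \<in> S"
    by (intro sv_submoduleD[OF S(1)] S(2) G(1))
  ultimately have "inverse (t * t - t) *s ((t * t - t) *s tri f h a) \<in> S"
    using sv_submoduleD(4)[OF S(1)] by metis
  moreover have "inverse (t * t - t) * (t * t - t) = 1"
    using t by (intro left_inverse) simp
  ultimately have "tri f h a \<in> S" by (simp only: vec.scale_scale vec.scale_one)
  then show ?thesis by (simp add: f_def[abs_def])
qed

text \<open>Take \<open>a = axis p 1\<close> and for \<open>h\<close> the coordinate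
  \<open>r\<close>. The resulting form \<open>f\<close> is 1 at \<open>axis q 1\<close> but
  otherwise unknown there and elsewhere except at \<open>a\<close>, where it vanishes; a
  transvection normalizes it to the coordinate \<open>q\<close>.\<close>

lemma unit_tri_mem_submodule:
  fixes lam :: "('a::field, 'n::finite) svec"
  assumes S: "sv_submodule S" "lam \<in> S"
    and lam: "lam \<in> M_star_star" and t: "t \<noteq> (0 :: 'a)" "t \<noteq> 1"
    and pqr: "distinct [p, q, r]" and one: "lam $ (p, q, r) = 1"
  shows "unit_tri q r p \<in> S"
proof -
  let ?a = "axis p (1 :: 'a) :: 'a ^ 'n"
  define f where "f x = alg_prod lam ?a x $ r" for x
  have f: "Vector_Spaces.linear (*s) (*) f"
    unfolding f_def by unfold_locales (simp_all add: alg_prod_bilinear)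
  have a: "?a $ r = 0" "?a \<noteq> 0" "?a $ q = 0" using pqr by (auto simp: axis_def vec_eq_iff)
  have mem: "tri f (\<lambda>x. x $ r) ?a \<in> S"
    using tri_mem_submodule[OF S lam linear_component a(1,2) t] by (simp add: f_def[abs_def])
  have "alg_prod lam ?a ?a \<in> vec.span {?a}" using lam by (simp add: M_star_star_def)
  then have fa: "f ?a = 0" using a(1) by (auto simp: f_def vec.span_singleton)
  have fq: "f (axis q 1) = 1" using one by (simp add: f_def alg_prod_axis)
  interpret f: Vector_Spaces.linear "(*s)" "(*)" f by (rule f)
  \<comment> \<open>Moving \<open>x\<close> by \<open>x $ q - f x\<close> along
    \<open>axis q 1\<close> changes \<open>f x\<close> into \<open>x $ q\<close>, and fixes both the
    coordinate \<open>r\<close> and the vector \<open>a\<close>.\<close>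
  have lin: "Vector_Spaces.linear (*s) (*) (\<lambda>x. x $ q - f x)"
    by unfold_locales (simp_all add: f.add f.scale algebra_simps)
  have "axis q 1 $ q - f (axis q 1) = 0" using fq by simp
  with lin obtain g where g: "invertible g"
    "\<And>x. g *v x = x + (x $ q - f x) *s axis q 1"
    "\<And>x. matrix_inv g *v x = x - (x $ q - f x) *s axis q 1"
    by (rule transvection) blast
  have "sv_act (tri f (\<lambda>x. x $ r) ?a) g = unit_tri q r p"
  proof -
    have "f (g *v x) = x $ q" for x by (simp only: g(2) f.add f.scale fq) simp
    moreover have "(g *v x) $ r = x $ r" for x using pqr by (auto simp: g(2) axis_def)
    moreover have "matrix_inv g *v ?a = ?a" by (simp only: g(3) fa a) simp
    ultimately show ?thesis by (simp add: sv_act_tri[OF f linear_component])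
  qed
  then show ?thesis using sv_submoduleD(5)[OF S(1) mem g(1)] by simp
qed

section \<open>A change of basis that makes one structure constant equal to 1\<close>

lemma M_star_star_act:
  assumes "lam \<in> M_star_star" "invertible g" shows "sv_act lam g \<in> M_star_star"
proof -
  have "alg_prod (sv_act lam g) v v \<in> vec.span {v}" for v
  proof -
    obtain c where "alg_prod lam (g *v v) (g *v v) = c *s (g *v v)"
      using assms(1) by (auto simp: M_star_star_def vec.span_singleton)
    then have "alg_prod (sv_act lam g) v v = c *s v"
      by (simp add: alg_prod_sv_act vec.scale matrix_inv_mult_vec[OF assms(2) refl])
    then show ?thesis by (simp add: vec.span_base vec.span_scale)
  qed
  then show ?thesis by (simp add: M_star_star_def)
qed

text \<open>Outside \<open>M_star\<close> some \<open>a\<close>, \<open>v\<close>,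
  \<open>[a,v]\<close> are linearly independent; taking them as basis vectors \<open>p\<close>,
  \<open>q\<close>, \<open>r\<close> makes the constant at \<open>(p, q, r)\<close> equal to
  1.\<close>

lemma unit_tri_in_FG_orbit:
  fixes lam :: "('a::field, 'n::finite) svec"
  assumes lam: "lam \<in> M_star_star" "lam \<notin> M_star" and t: "t \<noteq> (0 :: 'a)" "t \<noteq> 1"
    and pqr: "distinct [p, q, r]"
  shows "unit_tri p q r \<in> FG_orbit lam"
proof -
  obtain a v where av: "alg_prod lam a v \<notin> vec.span {a, v}"
    using lam(2) by (auto simp: M_star_def)
  let ?w = "alg_prod lam a v"
  have sq: "alg_prod lam x x \<in> vec.span {x}" for x using lam(1) by (simp add: M_star_star_def)
  have "a \<noteq> 0"
  proof
    assume "a = 0"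
    then have "?w = 0" using alg_prod_bilinear(3)[of lam 0 a v] by simp
    then show False using av by (simp add: vec.span_zero)
  qed
  \<comment> \<open>Otherwise \<open>[a,v]\<close> would be a multiple of \<open>[a,a]\<close>,
    which lies in the span of \<open>a\<close>.\<close>
  moreover have nv: "v \<notin> vec.span {a}"
  proof
    assume "v \<in> vec.span {a}"
    then obtain c where "v = c *s a" by (auto simp: vec.span_singleton)
    then have "?w \<in> vec.span {a}" using sq[of a] by (simp add: alg_prod_bilinear vec.span_scale)
    then show False using av vec.span_mono[of "{a}" "{a, v}"] by auto
  qed
  ultimately have ind: "vec.independent {?w, v, a}"
    using av by (intro vec.independent_insertI) (simp_all add: insert_commute vec.independent_empty)
  have neq: "v \<noteq> a" "?w \<noteq> a" "?w \<noteq> v"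
    using nv av vec.span_base[of a "{a}"] vec.span_base[of a "{a, v}"]
      vec.span_base[of v "{a, v}"] by auto
  define F where "F i = (if i = p then a else if i = q then v else ?w)" for i
  have F: "F p = a" "F q = v" "F r = ?w" using pqr by (auto simp: F_def)
  have "inj_on F {p, q, r}" using F neq by (auto simp: inj_on_def)
  moreover have "F ` {p, q, r} \<subseteq> {?w, v, a}" using F by auto
  ultimately obtain g where g: "invertible g" "\<And>i. i \<in> {p, q, r} \<Longrightarrow> g *v axis i 1 = F i"
    using independent_imp_columns[OF ind] by metis
  let ?mu = "sv_act lam g"
  have "alg_prod ?mu (axis p 1) (axis q 1) = axis r 1"
    unfolding alg_prod_sv_act using g(2) F by (intro matrix_inv_mult_vec[OF g(1)]) simp
  then have "?mu $ (p, q, r) = 1" by (simp flip: alg_prod_axis)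
  moreover have "?mu \<in> FG_orbit lam"
    using sv_submoduleD(5)[OF sv_submodule_FG_orbit FG_orbit_self g(1)] .
  \<comment> \<open>The indices come out cyclically shifted; a permutation of the basis restores
    their order.\<close>
  ultimately have "unit_tri q r p \<in> FG_orbit lam"
    using unit_tri_mem_submodule[OF sv_submodule_FG_orbit _ M_star_star_act[OF lam(1) g(1)] t pqr]
    by blast
  then show ?thesis
    by (rule unit_tri_permute[OF sv_submodule_FG_orbit]) (use pqr in auto)
qed

lemma eta_eq_unit_tri: "eta b = unit_tri (b 1) (b 2) (b 3)"
proof -
  have "eta b $ t = (unit_tri (b 1) (b 2) (b 3) :: ('a, 'b) svec) $ t" for t
  proof (cases t)
    case (fields x y z)
    show ?thesis
      unfolding fields unit_tri_component
      unfolding eta_def unit_sv_def axis_def vector_minus_component vec_lambda_beta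
        prod.inject of_bool_def ..
  qed
  then show ?thesis unfolding vec_eq_iff by blast
qed

text \<open>The product of basis vectors \<open>i\<close> and \<open>j\<close> is basis vector
  \<open>k\<close>, while their span lies in the hyperplane \<open>x $ k = 0\<close>.\<close>

lemma unit_tri_not_in_M_star:
  assumes "distinct [i, j, k]" shows "unit_tri i j k \<notin> M_star"
proof
  assume "unit_tri i j k \<in> (M_star :: ('b, 'a) svec set)"
  then have "alg_prod (unit_tri i j k) (axis i 1) (axis j 1)
      \<in> vec.span {axis i 1 :: 'b ^ 'a, axis j 1}"
    by (simp add: M_star_def)
  then have "axis k 1 \<in> vec.span {axis i 1 :: 'b ^ 'a, axis j 1}"
    using assms by (auto simp: alg_prod_tri linear_component axis_def)
  moreover have "vec.span {axis i 1 :: 'b ^ 'a, axis j 1} \<subseteq> {x. x $ k = 0}"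
    using assms by (intro vec.span_minimal) (auto simp: axis_def vec.subspace_def)
  ultimately show False by (auto simp: axis_def)
qed


section \<open>Irreducibility\<close>

lemma K_mod_subset_M_star_star: "K_mod \<subseteq> M_star_star"
  by (auto simp: K_mod_def M_star_star_def vec.span_zero)

text \<open>The preimage in \<open>U_mod\<close> of a nonzero submodule of the quotient contains a
  vector outside \<open>M_star\<close>, hence its whole orbit, hence \<open>U_mod\<close>.\<close>

lemma irreducible_quotient_U:
  assumes gen: "\<And>lam :: ('a::field, 'n::finite) svec. lam \<in> U_mod \<Longrightarrow> lam \<notin> M_star \<Longrightarrow>
      U_mod \<subseteq> FG_orbit lam"
    and ne: "\<not> (U_mod :: ('a, 'n) svec set) \<subseteq> M_star"
  shows "irreducible_gmodule (scalar_ring :: 'a ring) GL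
    (quotient_gmodule (sv_gmodule (U_mod :: ('a, 'n) svec set)) (U_mod \<inter> M_star))"
    (is "irreducible_gmodule _ _ ?Q")
proof -
  let ?U = "U_mod :: ('a, 'n) svec set"
  let ?N = "?U \<inter> M_star"
  let ?M = "sv_gmodule ?U"
  define Q where "Q x = (\<lambda>n. n + x) ` ?N" for x
  have coset: "?N +>\<^bsub>?M\<^esub> x = Q x" for x
    by (auto simp: a_r_coset_def r_coset_def sv_gmodule_def Q_def)
  have car: "carrier ?Q = Q ` ?U"
    by (auto simp: quotient_gmodule_def A_RCOSETS_def RCOSETS_def sv_gmodule_def Q_def r_coset_def)
  have zero: "\<zero>\<^bsub>?Q\<^esub> = ?N" by (simp add: quotient_gmodule_def)
  have N0: "0 \<in> ?N" using U_closed(1) M_closed(1) by simp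
  have self: "x \<in> Q x" for x using N0 by (force simp: Q_def)
  have Nadd: "n + m \<in> ?N" if "n \<in> ?N" "m \<in> ?N" for n m
    using that U_closed(2)[of n m] M_closed(2)[of n m] by simp
  have Nneg: "- n \<in> ?N" if "n \<in> ?N" for n
    using that U_closed(3)[of n "-1"] M_closed(3)[of n "-1"] by simp
  have Q_eq: "Q y = Q x" if y: "y \<in> Q x" for x y
  proof -
    obtain n where n: "n \<in> ?N" "y = n + x" using y unfolding Q_def by blast
    have "(m + n) + x \<in> Q x" if "m \<in> ?N" for m using Nadd[OF that n(1)] by (auto simp: Q_def)
    moreover have "m + x \<in> Q y" if "m \<in> ?N" for m
      using Nadd[OF that Nneg[OF n(1)]] n(2)
      unfolding Q_def by (intro image_eqI[of _ _ "m + - n"]) auto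
    ultimately show ?thesis using n(2) by (auto simp: Q_def add.assoc)
  qed
  have QN: "Q x = ?N" if "x \<in> ?N" for x using Q_eq[of x 0] that by (simp add: Q_def)
  have Q_subset: "Q x \<subseteq> ?U" if "x \<in> ?U" for x
    using that U_closed(2) by (auto simp: Q_def)
  have "W = {?N} \<or> W = carrier ?Q" if W: "G_submodule W scalar_ring GL ?Q" for W
  proof (cases "W \<subseteq> {?N}")
    case True
    \<comment> \<open>A submodule is a subgroup of the additive monoid, so \<open>one_closed\<close>
      says that \<open>W\<close> contains the zero coset \<open>?N\<close>.\<close>
    interpret submodule W "scalar_ring :: 'a ring" ?Q using W by (simp add: G_submodule_def)
    show ?thesis using True one_closed zero by auto
  next
    case False
    interpret submodule W "scalar_ring :: 'a ring" ?Q using W by (simp add: G_submodule_def)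
    have Wcar: "W \<subseteq> Q ` ?U" using subset car by simp
    have W_eq: "A = Q x" "x \<in> ?U" if A: "A \<in> W" "x \<in> A" for A x
    proof -
      obtain z where z: "z \<in> ?U" "A = Q z" using A(1) Wcar by blast
      show "A = Q x" using Q_eq[of x z] A(2) z(2) by simp
      show "x \<in> ?U" using Q_subset[OF z(1)] A(2) z(2) by blast
    qed
    \<comment> \<open>As \<open>W\<close> consists of cosets, \<open>\<Union>W\<close> is its
      preimage under the quotient map.\<close>
    have "sv_submodule (\<Union>W)"
      unfolding sv_submodule_def vec.subspace_def
    proof (intro conjI ballI allI impI)
      have "?N \<in> W" using one_closed zero by simp
      then show "0 \<in> \<Union>W" using N0 by blast
    next
      fix x y assume "x \<in> \<Union>W" "y \<in> \<Union>W"
      then obtain A B where AB: "A \<in> W" "x \<in> A" "B \<in> W" "y \<in> B" by blast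
      have "A \<oplus>\<^bsub>?Q\<^esub> B \<in> W" using m_closed[OF AB(1,3)] by simp
      moreover have "x + y \<in> A \<oplus>\<^bsub>?Q\<^esub> B"
        using AB(2,4) by (auto simp: quotient_gmodule_def set_add_def set_mult_def sv_gmodule_def)
      ultimately show "x + y \<in> \<Union>W" by blast
    next
      fix c x assume "x \<in> \<Union>W"
      then obtain A where A: "A \<in> W" "x \<in> A" by blast
      have "c \<odot>\<^bsub>?Q\<^esub> A \<in> W" using smult_closed[of c A] A(1) by (simp add: scalar_ring_def)
      moreover have "c *s x \<in> c \<odot>\<^bsub>?Q\<^esub> A"
        using A(2) self coset by (auto simp: quotient_gmodule_def sv_gmodule_def)
      ultimately show "c *s x \<in> \<Union>W" by blast
    next
      fix x and g :: "'a ^ 'n ^ 'n" assume "x \<in> \<Union>W" and g: "invertible g"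
      then obtain A where A: "A \<in> W" "x \<in> A" by blast
      have "act ?Q A g \<in> W" using W A(1) g by (simp add: G_submodule_def GL_def)
      moreover have "sv_act x g \<in> act ?Q A g"
        using A(2) self coset by (auto simp: quotient_gmodule_def sv_gmodule_def)
      ultimately show "sv_act x g \<in> \<Union>W" by blast
    qed
    moreover obtain x where x: "x \<in> \<Union>W" "x \<in> ?U" "x \<notin> M_star"
    proof -
      obtain A where A: "A \<in> W" "A \<noteq> ?N" using False by blast
      then obtain x where x: "x \<in> ?U" "A = Q x" using Wcar by blast
      then have "x \<notin> M_star" using A(2) QN by auto
      with x A(1) self show ?thesis by (intro that) auto
    qed
    ultimately have "?U \<subseteq> \<Union>W" using gen FG_orbit_subset by blast
    \<comment> \<open>Each \<open>x\<close> in \<open>?U\<close> lies in some member of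
      \<open>W\<close>, and that member must be its coset \<open>Q x\<close>.\<close>
    then have "Q ` ?U \<subseteq> W" using W_eq(1) by blast
    then show ?thesis using Wcar car by auto
  qed
  moreover have "carrier ?Q \<noteq> {?N}"
  proof -
    obtain x where "x \<in> ?U" "x \<notin> M_star" using ne by blast
    then show ?thesis using car self by blast
  qed
  ultimately show ?thesis
    by (simp add: irreducible_gmodule_def quotient_is_gmodule zero)
qed

theorem proposition9p1:
  fixes b :: "nat \<Rightarrow> 'n::finite"
  assumes card_F: "infinite (UNIV :: 'a::field set) \<or> CARD('a) > 2"
    and n_ge_3: "CARD('n) \<ge> 3"
    and basis: "bij_betw b {1..CARD('n)} UNIV"
  shows "(\<forall>lam :: ('a, 'n) svec. lam \<in> M_star_star \<and> lam \<notin> M_star \<longrightarrow>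
            linearly_degenerates lam (eta b) \<and> U_mod \<subseteq> FG_orbit lam)
       \<and> irreducible_gmodule (scalar_ring :: 'a ring) GL
           (quotient_gmodule (sv_gmodule (U_mod :: ('a, 'n) svec set)) (U_mod \<inter> M_star))"
proof -
  \<comment> \<open>Inclusion in \<open>{0, 1}\<close> would make the field finite with at most two
    elements.\<close>
  have "\<not> (UNIV :: 'a set) \<subseteq> {0, 1}"
    using card_F card_mono[of "{0, 1 :: 'a}" UNIV] by (auto intro: finite_subset)
  then obtain t :: 'a where t: "t \<noteq> 0" "t \<noteq> 1" by auto
  have "inj_on b {1..CARD('n)}" using basis by (simp add: bij_betw_def)
  then have d: "distinct [b 1, b 2, b 3]"
    using n_ge_3 by (auto simp: inj_on_eq_iff)
  have gen: "U_mod \<subseteq> FG_orbit lam"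
    if "lam \<in> M_star_star" "lam \<notin> M_star" for lam :: "('a, 'n) svec"
    using U_mod_subset_submodule[OF sv_submodule_FG_orbit unit_tri_in_FG_orbit[OF that t]] .
  moreover have "linearly_degenerates lam (eta b)"
    if "lam \<in> M_star_star" "lam \<notin> M_star" for lam :: "('a, 'n) svec"
    unfolding linearly_degenerates_def eta_eq_unit_tri
    by (rule unit_tri_in_FG_orbit[OF that t d])
  \<comment> \<open>The vector \<open>unit_tri (b 1) (b 2) (b 3)\<close>, which is
    \<open>eta b\<close>, makes the quotient nonzero.\<close>
  moreover have "\<not> (U_mod :: ('a, 'n) svec set) \<subseteq> M_star"
    using unit_tri_in_U_mod[OF d] unit_tri_not_in_M_star[OF d] by blast
  then have "irreducible_gmodule (scalar_ring :: 'a ring) GL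
      (quotient_gmodule (sv_gmodule (U_mod :: ('a, 'n) svec set)) (U_mod \<inter> M_star))"
    using gen K_mod_subset_M_star_star by (intro irreducible_quotient_U) (auto simp: U_mod_def)
  ultimately show ?thesis by blast
qed

end
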